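(* Let $\Gamma=(V,E,o,t)$ be a connected finite graph with finite modulus $\rho\colon I\to V$. Then the Abel--Jacobi map $\widetilde{\mathrm{AJ}}_{\mathfrak m}\colon\mathrm{Div}^0_{\mathfrak m}(\Gamma)\to\mathrm{J}_{\mathfrak m}(\Gamma)$ is surjective with kernel $\mathrm{Prin}_{\mathfrak m}(\Gamma)$, so it induces an isomorphism $\mathrm{AJ}_{\mathfrak m}\colon\mathrm{Cl}^0_{\mathfrak m}(\Gamma)\xrightarrow{\sim}\mathrm{J}_{\mathfrak m}(\Gamma)$.
   Context: Graph: $V\ne\emptyset$, $E$, $o,t\colon E\to V$ (loops, multiple edges allowed); finite, connected. Modulus: nonempty finite family $(w_i)_{i\in I}$ of vertices, $\rho(i)=w_i$, $I(v)=\rho^{-1}(v)$. $\partial=t-o\colon\mathbb{Z}[E]\to\mathbb{Z}[V]$, $H_1(\Gamma)=\ker\partial$; $\partial^*v=\sum_{t(e)=v}e-\sum_{o(e)=v}e$, $\Delta_0=\partial\partial^*$; $d^*\colon\mathbb{Z}^E\to\mathbb{Z}^V$, $(d^*\omega)(v)=\sum_{t(e)=v}\omega(e)-\sum_{o(e)=v}\omega(e)$. $\mathrm{Div}^0_{\mathfrak m}(\Gamma)=\mathbb{Z}[V]_0\oplus\mathbb{Z}[I]$; $\mathrm{Prin}_{\mathfrak m}(\Gamma)$ is the image of $\mathbb{Z}[V]\to\mathbb{Z}[V]\oplus\mathbb{Z}[I]$, $v\mapsto(\Delta_0v,\sum_{i\in I(v)}i)$; $\mathrm{Cl}^0_{\mathfrak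 m}=\mathrm{Div}^0_{\mathfrak m}/\mathrm{Prin}_{\mathfrak m}$. Extended graph $\Gamma_{\mathfrak m}$: add a vertex $\star$ and edges $e_i$ with $o(e_i)=\star$, $t(e_i)=w_i$; $C^1(\Gamma_{\mathfrak m})=\mathbb{Z}^E\oplus\mathbb{Z}^I$, $\mathcal{H}^1(\Gamma_{\mathfrak m})=\ker d^*_{\mathfrak m}$, $d^*_{\mathfrak m}(f,g)=(d^*f+r^*g,-\sum_ig(i))$, $(r^*g)(v)=\sum_{i\in I(v)}g(i)$. $M^\vee=\mathrm{Hom}(M,\mathbb{Z})$. $\alpha_{\mathfrak m}\colon H_1(\Gamma)\to\mathcal{H}^1(\Gamma_{\mathfrak m})^\vee$, $\gamma\mapsto((f,g)\mapsto f(\gamma))$; $\mathrm{J}_{\mathfrak m}(\Gamma)=\mathcal{H}^1(\Gamma_{\mathfrak m})^\vee/\alpha_{\mathfrak m}(H_1(\Gamma))$. $\widetilde{\mathrm{AJ}}_{\mathfrak m}$ is the homomorphism sending $(D,0)$, where $D=\partial\gamma_D$ with $\gamma_D\in\mathbb{Z}[E]$, to the class of $(f,g)\mapsto f(\gamma_D)$, and $(0,i)$ to the class of $(f,g)\mapsto g(i)$ (well defined modulo $\alpha_{\mathfrak m}(H_1(\Gamma))$). *)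

theory Defs
  imports
    "Graph_Theory.Digraph_Component"
    "HOL-Algebra.Free_Abelian_Groups"
begin

text \<open>
  A graph is a \<open>pre_digraph\<close> record: the origin map is \<open>tail\<close>, the terminus map is \<open>head\<close>.
  The group \<open>\<int>[S]\<close> is \<open>free_Abelian_group S\<close>, and \<open>\<int>\<^sup>S\<close> consists of the extensional functions
  in \<open>product_group S (\<lambda>_. integer_group)\<close>. A modulus is a map \<open>\<rho>\<close> from an index set \<open>I\<close>
  to the vertices.
\<close>

definition fiber :: "'i set \<Rightarrow> ('i \<Rightarrow> 'v) \<Rightarrow> 'v \<Rightarrow> 'i set" where
  "fiber I \<rho> v = {i \<in> I. \<rho> i = v}"

definition int_functions :: "'a set \<Rightarrow> ('a \<Rightarrow> int) monoid" where
  "int_functions S = product_group S (\<lambda>_. integer_group)"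

text \<open>The value \<open>f(c)\<close> of the linear extension of \<open>f\<close> at a formal sum \<open>c\<close>.\<close>

definition eval_at :: "('a \<Rightarrow> int) \<Rightarrow> ('a \<Rightarrow>\<^sub>0 int) \<Rightarrow> int" where
  "eval_at f c = (\<Sum>x\<in>Poly_Mapping.keys c. Poly_Mapping.lookup c x * f x)"

text \<open>\<open>Hom(M, \<int>)\<close>; homomorphisms are made extensional on the carrier, so that equality of
  functions is equality of homomorphisms.\<close>

definition dual_group :: "('m, 'b) monoid_scheme \<Rightarrow> ('m \<Rightarrow> int) monoid" where
  "dual_group M =
     \<lparr>carrier = hom M integer_group \<inter> extensional (carrier M),
      monoid.mult = (\<lambda>\<phi> \<psi>. \<lambda>x\<in>carrier M. \<phi> x + \<psi> x),
      one = (\<lambda>x\<in>carrier M. 0)\<rparr>"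


subsection \<open>Chains and cochains of a graph\<close>

definition boundary :: "('v, 'e) pre_digraph \<Rightarrow> ('e \<Rightarrow>\<^sub>0 int) \<Rightarrow> ('v \<Rightarrow>\<^sub>0 int)" where
  "boundary G = frag_extend (\<lambda>e. frag_of (head G e) - frag_of (tail G e))"

definition coboundary :: "('v, 'e) pre_digraph \<Rightarrow> ('v \<Rightarrow>\<^sub>0 int) \<Rightarrow> ('e \<Rightarrow>\<^sub>0 int)" where
  "coboundary G = frag_extend (\<lambda>v.
     (\<Sum>e\<in>{e \<in> arcs G. head G e = v}. frag_of e) - (\<Sum>e\<in>{e \<in> arcs G. tail G e = v}. frag_of e))"

definition laplacian :: "('v, 'e) pre_digraph \<Rightarrow> ('v \<Rightarrow>\<^sub>0 int) \<Rightarrow> ('v \<Rightarrow>\<^sub>0 int)" where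
  "laplacian G c = boundary G (coboundary G c)"

definition H1 :: "('v, 'e) pre_digraph \<Rightarrow> ('e \<Rightarrow>\<^sub>0 int) set" where
  "H1 G = kernel (free_Abelian_group (arcs G)) (free_Abelian_group (verts G)) (boundary G)"

definition codiff :: "('v, 'e) pre_digraph \<Rightarrow> ('e \<Rightarrow> int) \<Rightarrow> ('v \<Rightarrow> int)" where
  "codiff G \<omega> = (\<lambda>v\<in>verts G.
     (\<Sum>e\<in>{e \<in> arcs G. head G e = v}. \<omega> e) - (\<Sum>e\<in>{e \<in> arcs G. tail G e = v}. \<omega> e))"


subsection \<open>Divisors with modulus\<close>

definition deg :: "('v \<Rightarrow>\<^sub>0 int) \<Rightarrow> int" where
  "deg D = (\<Sum>v\<in>Poly_Mapping.keys D. Poly_Mapping.lookup D v)"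

definition Div0 :: "('v, 'e) pre_digraph \<Rightarrow> 'i set \<Rightarrow> (('v \<Rightarrow>\<^sub>0 int) \<times> ('i \<Rightarrow>\<^sub>0 int)) monoid" where
  "Div0 G I =
     (free_Abelian_group (verts G))
       \<lparr>carrier := {D \<in> carrier (free_Abelian_group (verts G)). deg D = 0}\<rparr>
     \<times>\<times> free_Abelian_group I"

definition Prin ::
  "('v, 'e) pre_digraph \<Rightarrow> 'i set \<Rightarrow> ('i \<Rightarrow> 'v) \<Rightarrow> (('v \<Rightarrow>\<^sub>0 int) \<times> ('i \<Rightarrow>\<^sub>0 int)) set" where
  "Prin G I \<rho> =
     (\<lambda>c. (laplacian G c, frag_extend (\<lambda>v. \<Sum>i\<in>fiber I \<rho> v. frag_of i) c))
       ` carrier (free_Abelian_group (verts G))"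

definition Cl0 ::
  "('v, 'e) pre_digraph \<Rightarrow> 'i set \<Rightarrow> ('i \<Rightarrow> 'v) \<Rightarrow> (('v \<Rightarrow>\<^sub>0 int) \<times> ('i \<Rightarrow>\<^sub>0 int)) set monoid" where
  "Cl0 G I \<rho> = Div0 G I Mod Prin G I \<rho>"


subsection \<open>Harmonic cochains of the extended graph\<close>

text \<open>The extended graph has the additional vertex \<open>None\<close> and an additional edge \<open>Inr i\<close> from
  \<open>None\<close> to \<open>\<rho> i\<close> for each \<open>i\<close>. Its cochains are represented as pairs in \<open>\<int>\<^sup>E \<oplus> \<int>\<^sup>I\<close>, and functions on
  its vertices as pairs in \<open>\<int>\<^sup>V \<oplus> \<int>\<close>; the lemma \<open>codiff_extended_graph\<close> below shows that
  \<open>codiff_mod\<close> is then the operator \<open>codiff\<close> of the extended graph.\<close>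

definition extended_graph ::
  "('v, 'e) pre_digraph \<Rightarrow> 'i set \<Rightarrow> ('i \<Rightarrow> 'v) \<Rightarrow> ('v option, 'e + 'i) pre_digraph" where
  "extended_graph G I \<rho> =
     \<lparr>verts = insert None (Some ` verts G),
      arcs = arcs G <+> I,
      tail = case_sum (\<lambda>e. Some (tail G e)) (\<lambda>_. None),
      head = case_sum (\<lambda>e. Some (head G e)) (\<lambda>i. Some (\<rho> i))\<rparr>"

definition C1_mod :: "('v, 'e) pre_digraph \<Rightarrow> 'i set \<Rightarrow> (('e \<Rightarrow> int) \<times> ('i \<Rightarrow> int)) monoid" where
  "C1_mod G I = int_functions (arcs G) \<times>\<times> int_functions I"

definition codiff_mod ::
  "('v, 'e) pre_digraph \<Rightarrow> 'i set \<Rightarrow> ('i \<Rightarrow> 'v) \<Rightarrow> ('e \<Rightarrow> int) \<times> ('i \<Rightarrow> int) \<Rightarrow> ('v \<Rightarrow> int) \<times> int" where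
  "codiff_mod G I \<rho> = (\<lambda>(f, g).
     (\<lambda>v\<in>verts G. codiff G f v + (\<Sum>i\<in>fiber I \<rho> v. g i), - (\<Sum>i\<in>I. g i)))"

definition harmonic_mod ::
  "('v, 'e) pre_digraph \<Rightarrow> 'i set \<Rightarrow> ('i \<Rightarrow> 'v) \<Rightarrow> (('e \<Rightarrow> int) \<times> ('i \<Rightarrow> int)) monoid" where
  "harmonic_mod G I \<rho> = (C1_mod G I)
     \<lparr>carrier :=
        kernel (C1_mod G I) (int_functions (verts G) \<times>\<times> integer_group) (codiff_mod G I \<rho>)\<rparr>"

lemma codiff_extended_graph:
  assumes "fin_digraph G" "finite I"
  shows "v \<in> verts G \<Longrightarrow>
           codiff (extended_graph G I \<rho>) (case_sum f g) (Some v) = fst (codiff_mod G I \<rho> (f, g)) v"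
    and "codiff (extended_graph G I \<rho>) (case_sum f g) None = snd (codiff_mod G I \<rho> (f, g))"
proof -
  interpret fin_digraph G by fact
  let ?X = "extended_graph G I \<rho>"
  have hS: "{e \<in> arcs ?X. head ?X e = Some v} = {e \<in> arcs G. head G e = v} <+> fiber I \<rho> v"
    and tS: "{e \<in> arcs ?X. tail ?X e = Some v} = {e \<in> arcs G. tail G e = v} <+> {}"
    and hN: "{e \<in> arcs ?X. head ?X e = None} = {}"
    and tN: "{e \<in> arcs ?X. tail ?X e = None} = {} <+> I" for v
    by (auto simp: extended_graph_def fiber_def)
  have fin: "finite (fiber I \<rho> v)" for v
    using assms(2) by (simp add: fiber_def)
  have V: "verts ?X = insert None (Some ` verts G)"
    by (simp add: extended_graph_def)
  show "codiff ?X (case_sum f g) (Some v) = fst (codiff_mod G I \<rho> (f, g)) v"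
    if "v \<in> verts G"
    using that fin by (simp add: codiff_def codiff_mod_def hS tS V sum.Plus)
  show "codiff ?X (case_sum f g) None = snd (codiff_mod G I \<rho> (f, g))"
    using assms(2) by (simp add: codiff_def codiff_mod_def hN tN V sum.Plus)
qed


subsection \<open>The Jacobian and the Abel--Jacobi map\<close>

text \<open>\<open>aj_functional G I \<rho> \<gamma> a\<close> is the homomorphism \<open>(f, g) \<mapsto> f(\<gamma>) + g(a)\<close>.\<close>

definition aj_functional ::
  "('v, 'e) pre_digraph \<Rightarrow> 'i set \<Rightarrow> ('i \<Rightarrow> 'v) \<Rightarrow> ('e \<Rightarrow>\<^sub>0 int) \<Rightarrow> ('i \<Rightarrow>\<^sub>0 int) \<Rightarrow>
     ('e \<Rightarrow> int) \<times> ('i \<Rightarrow> int) \<Rightarrow> int" where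
  "aj_functional G I \<rho> \<gamma> a =
     (\<lambda>(f, g)\<in>carrier (harmonic_mod G I \<rho>). eval_at f \<gamma> + eval_at g a)"

definition alpha_mod ::
  "('v, 'e) pre_digraph \<Rightarrow> 'i set \<Rightarrow> ('i \<Rightarrow> 'v) \<Rightarrow> ('e \<Rightarrow>\<^sub>0 int) \<Rightarrow> ('e \<Rightarrow> int) \<times> ('i \<Rightarrow> int) \<Rightarrow> int" where
  "alpha_mod G I \<rho> \<gamma> = (\<lambda>(f, g)\<in>carrier (harmonic_mod G I \<rho>). eval_at f \<gamma>)"

definition Jac_mod ::
  "('v, 'e) pre_digraph \<Rightarrow> 'i set \<Rightarrow> ('i \<Rightarrow> 'v) \<Rightarrow> (('e \<Rightarrow> int) \<times> ('i \<Rightarrow> int) \<Rightarrow> int) set monoid" where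
  "Jac_mod G I \<rho> = dual_group (harmonic_mod G I \<rho>) Mod (alpha_mod G I \<rho> ` H1 G)"

definition Jac_class ::
  "('v, 'e) pre_digraph \<Rightarrow> 'i set \<Rightarrow> ('i \<Rightarrow> 'v) \<Rightarrow> (('e \<Rightarrow> int) \<times> ('i \<Rightarrow> int) \<Rightarrow> int) \<Rightarrow>
     (('e \<Rightarrow> int) \<times> ('i \<Rightarrow> int) \<Rightarrow> int) set" where
  "Jac_class G I \<rho> \<phi> = (alpha_mod G I \<rho> ` H1 G) #>\<^bsub>dual_group (harmonic_mod G I \<rho>)\<^esub> \<phi>"

text \<open>The chain \<open>\<gamma>\<close> with boundary \<open>D\<close> is an arbitrary choice; the class does not depend on it, see
  \<open>AJ_tilde_boundary\<close> and \<open>AJ_tilde_index\<close>.\<close>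

definition AJ_tilde ::
  "('v, 'e) pre_digraph \<Rightarrow> 'i set \<Rightarrow> ('i \<Rightarrow> 'v) \<Rightarrow> ('v \<Rightarrow>\<^sub>0 int) \<times> ('i \<Rightarrow>\<^sub>0 int) \<Rightarrow>
     (('e \<Rightarrow> int) \<times> ('i \<Rightarrow> int) \<Rightarrow> int) set" where
  "AJ_tilde G I \<rho> = (\<lambda>(D, a).
     Jac_class G I \<rho> (aj_functional G I \<rho>
       (SOME \<gamma>. \<gamma> \<in> carrier (free_Abelian_group (arcs G)) \<and> boundary G \<gamma> = D) a))"

text \<open>The map induced on classes: \<open>AJ_tilde\<close> is constant on each coset \<open>X\<close> of \<open>Prin\<close>.\<close>

definition AJ ::
  "('v, 'e) pre_digraph \<Rightarrow> 'i set \<Rightarrow> ('i \<Rightarrow> 'v) \<Rightarrow> (('v \<Rightarrow>\<^sub>0 int) \<times> ('i \<Rightarrow>\<^sub>0 int)) set \<Rightarrow>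
     (('e \<Rightarrow> int) \<times> ('i \<Rightarrow> int) \<Rightarrow> int) set" where
  "AJ G I \<rho> X = the_elem (AJ_tilde G I \<rho> ` X)"

lemma eval_at_superset:
  assumes "finite S" "Poly_Mapping.keys c \<subseteq> S"
  shows "eval_at f c = (\<Sum>x\<in>S. Poly_Mapping.lookup c x * f x)"
  unfolding eval_at_def using assms
  by (intro sum.mono_neutral_left) (auto simp: in_keys_iff)

lemma eval_at_add: "eval_at f (c + d) = eval_at f c + eval_at f d"
proof -
  let ?S = "Poly_Mapping.keys c \<union> Poly_Mapping.keys d"
  have "Poly_Mapping.keys (c + d) \<subseteq> ?S" by (rule Poly_Mapping.keys_add)
  then show ?thesis
    by (simp add: eval_at_superset[of ?S] lookup_add sum.distrib distrib_right)
qed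

lemma eval_at_0 [simp]: "eval_at f 0 = 0"
  by (simp add: eval_at_def)

lemma eval_at_frag_of [simp]: "eval_at f (frag_of i) = f i"
  by (simp add: eval_at_def)

lemma mem_Jac_class_iff:
  "\<psi> \<in> Jac_class G I \<rho> (aj_functional G I \<rho> \<gamma> a) \<longleftrightarrow>
     (\<exists>\<eta>\<in>H1 G. \<psi> = aj_functional G I \<rho> (\<eta> + \<gamma>) a)"
proof -
  have "(\<lambda>x\<in>carrier (harmonic_mod G I \<rho>). alpha_mod G I \<rho> \<eta> x + aj_functional G I \<rho> \<gamma> a x)
          = aj_functional G I \<rho> (\<eta> + \<gamma>) a" for \<eta>
    by (rule ext) (auto simp: restrict_def alpha_mod_def aj_functional_def eval_at_add)
  then show ?thesis
    by (auto simp: Jac_class_def r_coset_def dual_group_def)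
qed

lemma H1_diff:
  assumes "\<gamma> \<in> carrier (free_Abelian_group (arcs G))" "\<gamma>' \<in> carrier (free_Abelian_group (arcs G))"
    and "boundary G \<gamma> = boundary G \<gamma>'"
  shows "\<gamma> - \<gamma>' \<in> H1 G"
  using assms Poly_Mapping.keys_diff[of \<gamma> \<gamma>']
  by (auto simp: H1_def kernel_def free_Abelian_group_def boundary_def frag_extend_diff)

lemma H1_add:
  assumes "\<gamma> \<in> H1 G" "\<gamma>' \<in> H1 G"
  shows "\<gamma> + \<gamma>' \<in> H1 G"
  using assms Poly_Mapping.keys_add[of \<gamma> \<gamma>']
  by (auto simp: H1_def kernel_def free_Abelian_group_def boundary_def frag_extend_add)

lemma Jac_class_eq:
  assumes "\<gamma> \<in> carrier (free_Abelian_group (arcs G))" "\<gamma>' \<in> carrier (free_Abelian_group (arcs G))"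
    and "boundary G \<gamma> = boundary G \<gamma>'"
  shows "Jac_class G I \<rho> (aj_functional G I \<rho> \<gamma> a) = Jac_class G I \<rho> (aj_functional G I \<rho> \<gamma>' a)"
proof -
  have "Jac_class G I \<rho> (aj_functional G I \<rho> x a) \<subseteq> Jac_class G I \<rho> (aj_functional G I \<rho> y a)"
    if xy: "x - y \<in> H1 G" for x y
  proof
    fix \<psi> assume "\<psi> \<in> Jac_class G I \<rho> (aj_functional G I \<rho> x a)"
    then obtain \<eta> where \<eta>: "\<eta> \<in> H1 G" "\<psi> = aj_functional G I \<rho> (\<eta> + x) a"
      unfolding mem_Jac_class_iff by blast
    have "\<eta> + (x - y) \<in> H1 G" "\<psi> = aj_functional G I \<rho> (\<eta> + (x - y) + y) a"
      using H1_add[OF \<eta>(1) xy] \<eta>(2) by simp_all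
    then show "\<psi> \<in> Jac_class G I \<rho> (aj_functional G I \<rho> y a)"
      unfolding mem_Jac_class_iff by blast
  qed
  from this[OF H1_diff[OF assms]] this[OF H1_diff[OF assms(2,1) assms(3)[symmetric]]]
  show ?thesis by blast
qed

lemma AJ_tilde_pair:
  assumes "\<gamma> \<in> carrier (free_Abelian_group (arcs G))"
  shows "AJ_tilde G I \<rho> (boundary G \<gamma>, a) = Jac_class G I \<rho> (aj_functional G I \<rho> \<gamma> a)"
proof -
  let ?P = "\<lambda>\<gamma>'. \<gamma>' \<in> carrier (free_Abelian_group (arcs G)) \<and> boundary G \<gamma>' = boundary G \<gamma>"
  have "?P (SOME \<gamma>'. ?P \<gamma>')"
    using assms by (intro someI[of ?P \<gamma>]) blast
  then show ?thesis
    unfolding AJ_tilde_def prod.case using assms by (intro Jac_class_eq) auto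
qed

lemma AJ_tilde_boundary:
  assumes "\<gamma> \<in> carrier (free_Abelian_group (arcs G))"
  shows "AJ_tilde G I \<rho> (boundary G \<gamma>, 0) =
     Jac_class G I \<rho> (\<lambda>(f, g)\<in>carrier (harmonic_mod G I \<rho>). eval_at f \<gamma>)"
  unfolding AJ_tilde_pair[OF assms] aj_functional_def by simp

lemma AJ_tilde_index:
  "AJ_tilde G I \<rho> (0, frag_of i) =
     Jac_class G I \<rho> (\<lambda>(f, g)\<in>carrier (harmonic_mod G I \<rho>). g i)"
proof -
  have "0 \<in> carrier (free_Abelian_group (arcs G))" "boundary G 0 = 0"
    by (simp_all add: free_Abelian_group_def boundary_def)
  from AJ_tilde_pair[OF this(1), of I \<rho> "frag_of i", unfolded this(2)]
  show ?thesis unfolding aj_functional_def by simp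
qed

end

theory Submission
  imports Defs
begin

text \<open>
  Harmonic cochains of the extended graph are its cycles, written as functions. Fix a chain \<open>p v\<close> from
  the added vertex to each vertex \<open>v\<close>. Closing up an edge \<open>s\<close> along these chains gives a cycle
  \<open>s - p (head s) + p (tail s)\<close>, and every cycle \<open>z\<close> is the combination of these with coefficients \<open>z s\<close>.
  Hence every functional on cycles extends to all chains, which gives surjectivity. A functional \<open>b\<close> on
  chains that vanishes on cycles is the difference of the potential \<open>v \<mapsto> b (p v)\<close>, which is zero at
  the added vertex; the functional of \<open>(\<gamma>, a)\<close> is therefore zero only if \<open>\<gamma>\<close> is the coboundary of some
  \<open>c\<close> and \<open>a\<close> its pullback along \<open>\<rho>\<close>, so that \<open>(\<partial>\<gamma>, a)\<close> is principal.
\<close>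

section \<open>Linear functionals on formal sums\<close>

lemma eval_at_diff: "eval_at f (c - d) = eval_at f c - eval_at f d"
  using eval_at_add[of f "c - d" d] by simp

lemma eval_at_minus: "eval_at f (- c) = - eval_at f c"
  using eval_at_diff[of f 0 c] by simp

lemma eval_at_sum: "eval_at f (\<Sum>i\<in>A. c i) = (\<Sum>i\<in>A. eval_at f (c i))"
  by (induction A rule: infinite_finite_induct) (auto simp: eval_at_add)

lemma eval_at_cong: "(\<And>x. x \<in> Poly_Mapping.keys c \<Longrightarrow> f x = g x) \<Longrightarrow> eval_at f c = eval_at g c"
  by (simp add: eval_at_def)

lemma eval_at_add_fun: "eval_at (\<lambda>x. f x + g x) c = eval_at f c + eval_at g c"
  by (simp add: eval_at_def distrib_left sum.distrib)

lemma eval_at_frag_extend: "eval_at f (frag_extend b c) = eval_at (\<lambda>x. eval_at f (b x)) c"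
  \<comment> \<open>With support bound \<open>UNIV\<close>, \<open>frag_induction\<close> ranges
    over all formal sums and asks only for zero, generators and differences.\<close>
  using subset_UNIV
  by (induction c rule: frag_induction) (auto simp: frag_extend_diff eval_at_diff)

text \<open>Makes each coefficient a linear functional, so that coefficients of boundaries and
  coboundaries come from the adjunction formulas for \<open>eval_at\<close>.\<close>

lemma lookup_conv_eval_at: "Poly_Mapping.lookup c x = eval_at (\<lambda>y. of_bool (y = x)) c"
  by (simp add: eval_at_superset[of "insert x (Poly_Mapping.keys c)"] subset_insertI)

lemma deg_conv_eval_at: "deg c = eval_at (\<lambda>_. 1) c"
  by (simp add: deg_def eval_at_def)

lemma frag_extend_fun_diff: "frag_extend (\<lambda>x. f x - g x) c = frag_extend f c - frag_extend g c"
  using subset_UNIV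
  by (induction c rule: frag_induction) (auto simp: frag_extend_diff)

lemma frag_extend_frag_extend:
  "frag_extend f (frag_extend g c) = frag_extend (\<lambda>x. frag_extend f (g x)) c"
  using subset_UNIV
  by (induction c rule: frag_induction) (auto simp: frag_extend_diff)

lemma frag_extend_const: "frag_extend (\<lambda>_. d) c = frag_cmul (deg c) d"
  using subset_UNIV
  by (induction c rule: frag_induction)
    (auto simp: frag_extend_diff deg_conv_eval_at eval_at_diff frag_cmul_diff_distrib)

lemma keys_diff_subset:
  "Poly_Mapping.keys c \<subseteq> S \<Longrightarrow> Poly_Mapping.keys d \<subseteq> S \<Longrightarrow> Poly_Mapping.keys (c - d) \<subseteq> S"
  using keys_diff[of c d] by blast

lemma keys_add_subset:
  "Poly_Mapping.keys c \<subseteq> S \<Longrightarrow> Poly_Mapping.keys d \<subseteq> S \<Longrightarrow> Poly_Mapping.keys (c + d) \<subseteq> S"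
  using Poly_Mapping.keys_add[of c d] by blast

lemma keys_frag_extend_subset:
  assumes "Poly_Mapping.keys c \<subseteq> S" "\<And>x. x \<in> S \<Longrightarrow> Poly_Mapping.keys (b x) \<subseteq> T"
  shows "Poly_Mapping.keys (frag_extend b c) \<subseteq> T"
  using keys_frag_extend[of b c] assms by blast

lemma keys_sum_frag_of_subset: "A \<subseteq> S \<Longrightarrow> Poly_Mapping.keys (\<Sum>x\<in>A. frag_of x) \<subseteq> S"
  using keys_sum[of frag_of A] by auto

text \<open>The passage from functions to formal sums that identifies them when \<open>S\<close> is
  finite.\<close>

definition frag_of_fun :: "'a set \<Rightarrow> ('a \<Rightarrow> int) \<Rightarrow> ('a \<Rightarrow>\<^sub>0 int)" where
  "frag_of_fun S f = (\<Sum>x\<in>S. frag_cmul (f x) (frag_of x))"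

lemma lookup_frag_of_fun:
  "finite S \<Longrightarrow> Poly_Mapping.lookup (frag_of_fun S f) x = (if x \<in> S then f x else 0)"
  by (simp add: frag_of_fun_def lookup_sum if_distrib cong: if_cong)

lemma keys_frag_of_fun: "finite S \<Longrightarrow> Poly_Mapping.keys (frag_of_fun S f) \<subseteq> S"
  by (metis in_keys_iff lookup_frag_of_fun subsetI)


section \<open>Chains of a graph\<close>

lemma boundary_0 [simp]: "boundary G 0 = 0"
  by (simp add: boundary_def)

lemma boundary_frag_of [simp]: "boundary G (frag_of e) = frag_of (head G e) - frag_of (tail G e)"
  by (simp add: boundary_def)

lemma boundary_add: "boundary G (c + d) = boundary G c + boundary G d"
  by (simp add: boundary_def frag_extend_add)

lemma boundary_diff: "boundary G (c - d) = boundary G c - boundary G d"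
  by (simp add: boundary_def frag_extend_diff)

lemma boundary_frag_extend:
  "boundary G (frag_extend b c) = frag_extend (\<lambda>x. boundary G (b x)) c"
  by (simp add: boundary_def frag_extend_frag_extend)

text \<open>Adjunction between boundary and differential. Constant \<open>f\<close> gives
  \<open>deg_boundary\<close>; an indicator gives the coefficients in
  \<open>lookup_boundary\<close>.\<close>

lemma eval_at_boundary:
  "eval_at f (boundary G c) = eval_at (\<lambda>e. f (head G e) - f (tail G e)) c"
  by (simp add: boundary_def eval_at_frag_extend eval_at_diff)

lemma deg_boundary: "deg (boundary G c) = 0"
  by (simp add: deg_conv_eval_at eval_at_boundary) (simp add: eval_at_def)

text \<open>The other adjunction: on vertices of \<open>G\<close> the integrand is
  \<open>codiff G f\<close>.\<close>

lemma eval_at_coboundary: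
  "eval_at f (coboundary G c) =
     eval_at (\<lambda>v. (\<Sum>e\<in>{e \<in> arcs G. head G e = v}. f e) - (\<Sum>e\<in>{e \<in> arcs G. tail G e = v}. f e)) c"
  by (simp add: coboundary_def eval_at_frag_extend eval_at_diff eval_at_sum)

lemma mem_H1_iff: "z \<in> H1 G \<longleftrightarrow> Poly_Mapping.keys z \<subseteq> arcs G \<and> boundary G z = 0"
  by (simp add: H1_def kernel_def)

context wf_digraph
begin

lemma keys_boundary: "Poly_Mapping.keys c \<subseteq> arcs G \<Longrightarrow> Poly_Mapping.keys (boundary G c) \<subseteq> verts G"
  unfolding boundary_def by (rule keys_frag_extend_subset[of _ "arcs G"]) (simp_all add: keys_diff_subset)

lemma keys_coboundary: "Poly_Mapping.keys (coboundary G c) \<subseteq> arcs G"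
  unfolding coboundary_def
  by (rule keys_frag_extend_subset[OF subset_UNIV])
    (intro keys_diff_subset keys_sum_frag_of_subset, auto)

text \<open>Follow a walk from \<open>u\<close> to \<open>v\<close> in the symmetrized graph and add
  up its edges; an edge crossed against its orientation counts with a minus sign.\<close>

lemma connected_imp_boundary_exists:
  assumes "connected G" "u \<in> verts G" "v \<in> verts G"
  shows "\<exists>\<gamma>. Poly_Mapping.keys \<gamma> \<subseteq> arcs G \<and> boundary G \<gamma> = frag_of v - frag_of u"
proof -
  have "u \<rightarrow>\<^sup>*\<^bsub>mk_symmetric G\<^esub> v"
    using assms unfolding connected_def strongly_connected_def by simp
  then have "(u, v) \<in> (parcs (mk_symmetric G))\<^sup>*"
    using reachable_rtranclI[of "with_proj (mk_symmetric G)" u v] by simp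
  then show ?thesis
  proof (induction rule: rtrancl_induct)
    case base
    show ?case by (intro exI[of _ 0]) simp
  next
    case (step y z)
    obtain \<gamma> where \<gamma>: "Poly_Mapping.keys \<gamma> \<subseteq> arcs G" "boundary G \<gamma> = frag_of y - frag_of u"
      using step.IH by blast
    obtain e where e: "e \<in> arcs G" "y = tail G e \<and> z = head G e \<or> y = head G e \<and> z = tail G e"
      using step.hyps(2) unfolding parcs_mk_symmetric by blast
    from e(2) show ?case
    proof
      assume "y = tail G e \<and> z = head G e"
      then show ?thesis
        using \<gamma> e(1) by (intro exI[of _ "\<gamma> + frag_of e"]) (simp add: boundary_add keys_add_subset)
    next
      assume "y = head G e \<and> z = tail G e"
      then show ?thesis
        using \<gamma> e(1) by (intro exI[of _ "\<gamma> - frag_of e"]) (simp add: boundary_diff keys_diff_subset)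
    qed
  qed
qed

text \<open>Combining chains from a base vertex \<open>u\<close> with the coefficients of
  \<open>D\<close> gives boundary \<open>D\<close> minus \<open>deg D\<close> times
  \<open>u\<close>, and the second term vanishes.\<close>

lemma deg_0_imp_boundary:
  assumes "connected G" "Poly_Mapping.keys D \<subseteq> verts G" "deg D = 0"
  obtains \<gamma> where "Poly_Mapping.keys \<gamma> \<subseteq> arcs G" "boundary G \<gamma> = D"
proof -
  obtain u where u: "u \<in> verts G"
    using assms(1) by (auto simp: connected_def strongly_connected_def)
  obtain p where p: "\<And>v. v \<in> verts G \<Longrightarrow>
      Poly_Mapping.keys (p v) \<subseteq> arcs G \<and> boundary G (p v) = frag_of v - frag_of u"
    using connected_imp_boundary_exists[OF assms(1) u] by metis
  have "boundary G (frag_extend p D) = frag_extend (\<lambda>v. frag_of v - frag_of u) D"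
    unfolding boundary_frag_extend using assms(2) p by (intro frag_extend_eq) blast
  also have "\<dots> = D"
    using assms(3) by (simp add: frag_extend_fun_diff frag_extend_const flip: frag_expansion)
  finally have "boundary G (frag_extend p D) = D" .
  moreover have "Poly_Mapping.keys (frag_extend p D) \<subseteq> arcs G"
    using assms(2) p by (intro keys_frag_extend_subset[of D "verts G"]) simp_all
  ultimately show thesis by (rule that[rotated])
qed

end

text \<open>The bridge between chains and cochains: once coefficients are read as a function, being
  a cycle means being harmonic.\<close>

lemma (in fin_digraph) lookup_boundary:
  assumes "Poly_Mapping.keys c \<subseteq> arcs G" "v \<in> verts G"
  shows "Poly_Mapping.lookup (boundary G c) v = codiff G (Poly_Mapping.lookup c) v"
proof -
  have "Poly_Mapping.lookup (boundary G c) v =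
      (\<Sum>e\<in>arcs G. Poly_Mapping.lookup c e * (of_bool (head G e = v) - of_bool (tail G e = v)))"
    using assms(1) by (simp add: lookup_conv_eval_at[of "boundary G c"] eval_at_boundary
        eval_at_superset[of "arcs G"])
  then show ?thesis
    using assms(2) by (simp add: codiff_def right_diff_distrib sum_subtractf Int_def)
qed

lemma (in fin_digraph) lookup_coboundary:
  assumes "e \<in> arcs G"
  shows "Poly_Mapping.lookup (coboundary G c) e =
     Poly_Mapping.lookup c (head G e) - Poly_Mapping.lookup c (tail G e)"
proof -
  \<comment> \<open>Here \<open>h\<close> stands for both \<open>head G\<close> and
    \<open>tail G\<close>; the edge \<open>e\<close> is counted only at its own end.\<close>
  have "(\<Sum>e'\<in>{e' \<in> arcs G. h e' = v}. of_bool (e' = e)) = (of_bool (v = h e) :: int)" for h :: "'b \<Rightarrow> 'a" and v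
    using assms by (auto simp: of_bool_def)
  then show ?thesis
    by (simp add: lookup_conv_eval_at eval_at_coboundary)
      (simp add: eval_at_def right_diff_distrib sum_subtractf)
qed


section \<open>Cycles and potentials\<close>

text \<open>The map \<open>p\<close> replaces a spanning tree.\<close>

locale rooted_graph = wf_digraph G for G :: "('v, 'e) pre_digraph" +
  fixes root :: 'v and p :: "'v \<Rightarrow> 'e \<Rightarrow>\<^sub>0 int"
  assumes keys_p: "v \<in> verts G \<Longrightarrow> Poly_Mapping.keys (p v) \<subseteq> arcs G"
    and boundary_p: "v \<in> verts G \<Longrightarrow> boundary G (p v) = frag_of v - frag_of root"
begin

definition loop :: "'e \<Rightarrow> 'e \<Rightarrow>\<^sub>0 int" where
  "loop s = frag_of s - (p (head G s) - p (tail G s))"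

lemma loop_in_H1: "s \<in> arcs G \<Longrightarrow> loop s \<in> H1 G"
  by (simp add: loop_def mem_H1_iff boundary_diff boundary_p keys_diff_subset keys_p)

text \<open>The correction terms of the loops add up to \<open>frag_extend p (boundary G z)\<close>,
  which is zero for a cycle.\<close>

lemma cycle_eq_frag_extend_loop:
  assumes "z \<in> H1 G"
  shows "frag_extend loop z = z"
proof -
  have "frag_extend loop z = z - frag_extend p (boundary G z)"
    by (simp add: loop_def[abs_def] frag_extend_fun_diff boundary_def frag_extend_frag_extend
        frag_extend_diff flip: frag_expansion)
  then show ?thesis
    using assms by (simp add: mem_H1_iff)
qed

text \<open>The right-hand side makes sense for every chain, so it extends a functional given only
  on cycles.\<close>

lemma additive_on_cycles_eq_eval_at:
  assumes \<phi>: "\<And>x y. x \<in> H1 G \<Longrightarrow> y \<in> H1 G \<Longrightarrow> \<phi> (x + y) = \<phi> x + (\<phi> y :: int)"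
    and z: "z \<in> H1 G"
  shows "\<phi> z = eval_at (\<lambda>s. \<phi> (loop s)) z"
proof -
  have 0: "0 \<in> H1 G" by (simp add: mem_H1_iff)
  have diff: "x - y \<in> H1 G" if "x \<in> H1 G" "y \<in> H1 G" for x y
    using that by (simp add: mem_H1_iff boundary_diff keys_diff_subset)
  have \<phi>_diff: "\<phi> (x - y) = \<phi> x - \<phi> y" if "x \<in> H1 G" "y \<in> H1 G" for x y
    using \<phi>[OF diff[OF that] that(2)] by simp
  \<comment> \<open>Single edges need not be cycles, so the induction runs over all chains
    \<open>x\<close> and speaks of the cycle \<open>frag_extend loop x\<close>; for a cycle this is
    \<open>x\<close> again.\<close>
  have "frag_extend loop x \<in> H1 G \<and> \<phi> (frag_extend loop x) = eval_at (\<lambda>s. \<phi> (loop s)) x"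
    if "Poly_Mapping.keys x \<subseteq> arcs G" for x
    using that
  proof (induction x rule: frag_induction)
    case zero
    show ?case using 0 \<phi>[OF 0 0] by simp
  next
    case (one x)
    then show ?case by (simp add: loop_in_H1)
  next
    case (diff a b)
    then show ?case
      by (simp add: frag_extend_diff eval_at_diff \<phi>_diff \<open>\<And>x y. x \<in> H1 G \<Longrightarrow> y \<in> H1 G \<Longrightarrow> x - y \<in> H1 G\<close>)
  qed
  from this[of z] show ?thesis
    using z by (simp add: cycle_eq_frag_extend_loop mem_H1_iff)
qed

text \<open>Vanishing on \<open>loop s\<close> says that \<open>b s\<close> is the difference of the
  potential \<open>eval_at b (p v)\<close> between the ends of \<open>s\<close>.\<close>

lemma vanishing_on_cycles_imp_potential:
  assumes b: "\<And>z. z \<in> H1 G \<Longrightarrow> eval_at b z = 0"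
  shows "s \<in> arcs G \<Longrightarrow> b s = eval_at b (p (head G s)) - eval_at b (p (tail G s))"
    and "root \<in> verts G \<Longrightarrow> eval_at b (p root) = 0"
proof -
  show "b s = eval_at b (p (head G s)) - eval_at b (p (tail G s))" if "s \<in> arcs G"
    using b[OF loop_in_H1[OF that]] by (simp add: loop_def eval_at_diff)
  \<comment> \<open>The chain \<open>p root\<close> may be nonzero, but its boundary is zero, so it
    is a cycle.\<close>
  show "eval_at b (p root) = 0" if "root \<in> verts G"
    using that by (intro b) (simp add: mem_H1_iff keys_p boundary_p)
qed

end

section \<open>Homomorphisms to the integers\<close>

lemma carrier_dual_group:
  "\<phi> \<in> carrier (dual_group M) \<longleftrightarrow>
     (\<forall>x\<in>carrier M. \<forall>y\<in>carrier M. \<phi> (x \<otimes>\<^bsub>M\<^esub> y) = \<phi> x + \<phi> y) \<and> \<phi> \<in> extensional (carrier M)"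
  by (auto simp: dual_group_def hom_def)

lemma one_dual_group: "\<one>\<^bsub>dual_group M\<^esub> = (\<lambda>x\<in>carrier M. 0)"
  and mult_dual_group: "\<phi> \<otimes>\<^bsub>dual_group M\<^esub> \<psi> = (\<lambda>x\<in>carrier M. \<phi> x + \<psi> x)"
  by (simp_all add: dual_group_def)

text \<open>Commutativity makes every subgroup of the dual normal, as the quotient defining the
  Jacobian requires.\<close>

lemma comm_group_dual_group:
  assumes "group M"
  shows "comm_group (dual_group M)"
proof -
  interpret M: group M by fact
  show ?thesis
  proof (rule comm_groupI)
    fix \<phi> assume \<phi>: "\<phi> \<in> carrier (dual_group M)"
    show "\<one>\<^bsub>dual_group M\<^esub> \<otimes>\<^bsub>dual_group M\<^esub> \<phi> = \<phi>"
      using \<phi> by (auto simp: carrier_dual_group one_dual_group mult_dual_group fun_eq_iff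
          restrict_def extensional_def)
    show "\<exists>\<psi>\<in>carrier (dual_group M). \<psi> \<otimes>\<^bsub>dual_group M\<^esub> \<phi> = \<one>\<^bsub>dual_group M\<^esub>"
      using \<phi> by (intro bexI[of _ "\<lambda>x\<in>carrier M. - \<phi> x"])
        (auto simp: carrier_dual_group one_dual_group mult_dual_group fun_eq_iff)
  qed (auto simp: carrier_dual_group one_dual_group mult_dual_group fun_eq_iff)
qed


section \<open>The extended graph\<close>

lemma carrier_int_functions: "carrier (int_functions S) = extensional S"
  by (simp add: int_functions_def PiE_def)

lemma mult_int_functions: "f \<otimes>\<^bsub>int_functions S\<^esub> g = (\<lambda>x\<in>S. f x + g x)"
  by (simp add: int_functions_def)

lemma one_int_functions: "\<one>\<^bsub>int_functions S\<^esub> = (\<lambda>x\<in>S. 0)"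
  by (simp add: int_functions_def)

lemma group_int_functions: "group (int_functions S)"
  by (simp add: int_functions_def)

locale graph_with_modulus = fin_digraph G for G :: "('v, 'e) pre_digraph" +
  fixes I :: "'i set" and \<rho> :: "'i \<Rightarrow> 'v"
  assumes connected_G: "connected G"
    and finite_I: "finite I" and I_nonempty: "I \<noteq> {}"
    and modulus_in_verts: "i \<in> I \<Longrightarrow> \<rho> i \<in> verts G"
begin

abbreviation X where "X \<equiv> extended_graph G I \<rho>"
abbreviation H where "H \<equiv> harmonic_mod G I \<rho>"

lemma extended_graph_simps [simp]:
  "verts X = insert None (Some ` verts G)" "arcs X = arcs G <+> I"
  "tail X (Inl e) = Some (tail G e)" "tail X (Inr i) = None"
  "head X (Inl e) = Some (head G e)" "head X (Inr i) = Some (\<rho> i)"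
  by (simp_all add: extended_graph_def)

lemma fin_digraph_extended_graph: "fin_digraph X"
  by unfold_locales (auto simp: finite_I modulus_in_verts)

text \<open>From the added vertex, cross one fixed edge \<open>Inr i\<close> to
  \<open>\<rho> i\<close> and continue inside \<open>G\<close>. This is where the nonempty modulus
  and the connectedness of \<open>G\<close> enter.\<close>

lemma extended_graph_rooted: "\<exists>p. rooted_graph X None p"
proof -
  interpret X: fin_digraph X by (rule fin_digraph_extended_graph)
  obtain i where i: "i \<in> I" using I_nonempty by blast
  obtain q where q: "\<And>v. v \<in> verts G \<Longrightarrow>
      Poly_Mapping.keys (q v) \<subseteq> arcs G \<and> boundary G (q v) = frag_of v - frag_of (\<rho> i)"
    using connected_imp_boundary_exists[OF connected_G modulus_in_verts[OF i]] by metis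
  define p where "p x = (case x of None \<Rightarrow> 0
    | Some v \<Rightarrow> frag_extend (\<lambda>e. frag_of (Inl e)) (q v) + frag_of (Inr i))" for x
  \<comment> \<open>The inclusion of \<open>G\<close> into \<open>X\<close> commutes with the
    boundary.\<close>
  have "boundary X (frag_extend (\<lambda>e. frag_of (Inl e)) c) = frag_extend (\<lambda>v. frag_of (Some v)) (boundary G c)"
    for c
    by (simp add: boundary_frag_extend) (simp add: boundary_def frag_extend_frag_extend frag_extend_diff)
  then have bd: "boundary X (p (Some v)) = frag_of (Some v) - frag_of None" if "v \<in> verts G" for v
    using q[OF that] by (simp add: p_def boundary_add frag_extend_diff)
  have "Poly_Mapping.keys (p (Some v)) \<subseteq> arcs X" if "v \<in> verts G" for v
    using q[OF that] i unfolding p_def option.case extended_graph_simps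
    by (intro keys_add_subset keys_frag_extend_subset[of _ "arcs G"]) auto
  with bd have "Poly_Mapping.keys (p x) \<subseteq> arcs X \<and> boundary X (p x) = frag_of x - frag_of None"
    if "x \<in> verts X" for x
    using that by (cases x) (auto simp: p_def[of None])
  then have "rooted_graph X None p"
    by unfold_locales simp_all
  then show ?thesis by blast
qed

section \<open>Harmonic cochains as cycles of the extended graph\<close>

lemma mem_harmonic_iff:
  "(f, g) \<in> carrier H \<longleftrightarrow> f \<in> extensional (arcs G) \<and> g \<in> extensional I \<and>
     (\<forall>v\<in>verts G. codiff G f v + (\<Sum>i\<in>fiber I \<rho> v. g i) = 0) \<and> (\<Sum>i\<in>I. g i) = 0"
  by (auto simp: harmonic_mod_def kernel_def C1_mod_def carrier_int_functions codiff_mod_def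
      one_int_functions fun_eq_iff restrict_def)

lemma mult_harmonic:
  "(f, g) \<otimes>\<^bsub>H\<^esub> (f', g') = (\<lambda>e\<in>arcs G. f e + f' e, \<lambda>i\<in>I. g i + g' i)"
  by (simp add: harmonic_mod_def C1_mod_def mult_int_functions)

lemma group_harmonic: "group H"
proof -
  have C: "group (C1_mod G I)" and K: "group (int_functions (verts G) \<times>\<times> integer_group)"
    by (simp_all add: C1_mod_def DirProd_group group_int_functions)
  have "codiff_mod G I \<rho> \<in> hom (C1_mod G I) (int_functions (verts G) \<times>\<times> integer_group)"
    by (rule homI) (auto simp: C1_mod_def codiff_mod_def carrier_int_functions mult_int_functions
        fun_eq_iff codiff_def fiber_def sum.distrib)
  then interpret group_hom "C1_mod G I" "int_functions (verts G) \<times>\<times> integer_group" "codiff_mod G I \<rho>"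
    using C K by (simp add: group_hom_def group_hom_axioms_def)
  show ?thesis
    unfolding harmonic_mod_def using subgroup.subgroup_is_group[OF subgroup_kernel C] .
qed

definition harmonic_of :: "('e + 'i \<Rightarrow>\<^sub>0 int) \<Rightarrow> ('e \<Rightarrow> int) \<times> ('i \<Rightarrow> int)" where
  "harmonic_of z = (\<lambda>e\<in>arcs G. Poly_Mapping.lookup z (Inl e), \<lambda>i\<in>I. Poly_Mapping.lookup z (Inr i))"

lemma harmonic_of_add: "harmonic_of (z + z') = harmonic_of z \<otimes>\<^bsub>H\<^esub> harmonic_of z'"
  by (auto simp: harmonic_of_def mult_harmonic lookup_add fun_eq_iff)

text \<open>By \<open>lookup_boundary\<close>, the coefficients of the boundary of \<open>z\<close>
  are the components of \<open>codiff_mod\<close> at \<open>harmonic_of z\<close>.\<close>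

lemma harmonic_of_mem_iff:
  assumes "Poly_Mapping.keys z \<subseteq> arcs X"
  shows "harmonic_of z \<in> carrier H \<longleftrightarrow> z \<in> H1 X"
proof -
  interpret X: fin_digraph X by (rule fin_digraph_extended_graph)
  let ?f = "fst (harmonic_of z)" and ?g = "snd (harmonic_of z)"
  \<comment> \<open>The restrictions in \<open>harmonic_of\<close> do no harm, since
    \<open>codiff\<close> only sees values on arcs.\<close>
  have lookup_eq: "Poly_Mapping.lookup (boundary X z) x = codiff X (case_sum ?f ?g) x"
    if "x \<in> verts X" for x
    using X.lookup_boundary[OF assms that] that
    by (auto simp: codiff_def harmonic_of_def intro!: arg_cong2[where f = "(-)"] sum.cong)
  have "boundary X z = 0 \<longleftrightarrow> (\<forall>x\<in>verts X. Poly_Mapping.lookup (boundary X z) x = 0)"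
    using X.keys_boundary[OF assms] by (auto simp: in_keys_iff subset_iff poly_mapping_eq_iff fun_eq_iff)
  also have "\<dots> \<longleftrightarrow> (\<forall>v\<in>verts G. fst (codiff_mod G I \<rho> (?f, ?g)) v = 0) \<and> snd (codiff_mod G I \<rho> (?f, ?g)) = 0"
    using codiff_extended_graph[OF fin_digraph_axioms finite_I, where \<rho> = \<rho> and f = ?f and g = ?g]
    by (auto simp: lookup_eq)
  also have "\<dots> \<longleftrightarrow> harmonic_of z \<in> carrier H"
    using mem_harmonic_iff[of ?f ?g] by (auto simp: codiff_mod_def harmonic_of_def)
  finally show ?thesis
    using assms by (simp add: mem_H1_iff)
qed

lemma harmonic_of_surj:
  assumes "(f, g) \<in> carrier H"
  obtains z where "z \<in> H1 X" "harmonic_of z = (f, g)"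
proof -
  define z where "z = frag_of_fun (arcs X) (case_sum f g)"
  have "finite (arcs X)" using finite_I by simp
  then have keys: "Poly_Mapping.keys z \<subseteq> arcs X" and
    "harmonic_of z = (\<lambda>e\<in>arcs G. f e, \<lambda>i\<in>I. g i)"
    unfolding z_def by (rule keys_frag_of_fun) (auto simp: harmonic_of_def lookup_frag_of_fun finite_I fun_eq_iff)
  then have "harmonic_of z = (f, g)"
    using assms by (simp add: mem_harmonic_iff extensional_restrict)
  with that assms show thesis
    using harmonic_of_mem_iff[OF keys] by simp
qed


section \<open>The Abel--Jacobi map\<close>

lemma aj_functional_apply:
  "(f, g) \<in> carrier H \<Longrightarrow> aj_functional G I \<rho> \<gamma> a (f, g) = eval_at f \<gamma> + eval_at g a"
  by (simp add: aj_functional_def)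

text \<open>The sum of products of coefficients is symmetric, so the pair of chains can act as the
  function and the harmonic cochain as the cycle. The results on cycles then apply.\<close>

lemma aj_functional_harmonic_of:
  assumes "z \<in> H1 X" "Poly_Mapping.keys \<gamma> \<subseteq> arcs G" "Poly_Mapping.keys a \<subseteq> I"
  shows "aj_functional G I \<rho> \<gamma> a (harmonic_of z) =
     eval_at (case_sum (Poly_Mapping.lookup \<gamma>) (Poly_Mapping.lookup a)) z"
proof -
  have z: "Poly_Mapping.keys z \<subseteq> arcs G <+> I" "harmonic_of z \<in> carrier H"
    using assms(1) harmonic_of_mem_iff[of z] by (auto simp: mem_H1_iff)
  have "eval_at (case_sum (Poly_Mapping.lookup \<gamma>) (Poly_Mapping.lookup a)) z =
      (\<Sum>e\<in>arcs G. Poly_Mapping.lookup \<gamma> e * Poly_Mapping.lookup z (Inl e)) +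
      (\<Sum>i\<in>I. Poly_Mapping.lookup a i * Poly_Mapping.lookup z (Inr i))"
    using z(1) finite_I by (simp add: eval_at_superset[of "arcs G <+> I"] sum.Plus mult.commute)
  then show ?thesis
    using z(2) assms(2,3) finite_I
    by (simp add: harmonic_of_def aj_functional_apply eval_at_superset[of "arcs G" \<gamma>] eval_at_superset[of I a])
qed

lemma aj_functional_in_dual:
  assumes "Poly_Mapping.keys \<gamma> \<subseteq> arcs G" "Poly_Mapping.keys a \<subseteq> I"
  shows "aj_functional G I \<rho> \<gamma> a \<in> carrier (dual_group H)"
proof -
  have "aj_functional G I \<rho> \<gamma> a (x \<otimes>\<^bsub>H\<^esub> y) = aj_functional G I \<rho> \<gamma> a x + aj_functional G I \<rho> \<gamma> a y"
    if "x \<in> carrier H" "y \<in> carrier H" for x y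
  proof -
    obtain f g f' g' where xy: "x = (f, g)" "y = (f', g')" by fastforce
    have "(\<lambda>e\<in>arcs G. f e + f' e, \<lambda>i\<in>I. g i + g' i) \<in> carrier H"
      using group.subgroup_self[OF group_harmonic] that
      by (metis xy mult_harmonic subgroup.m_closed)
    moreover have "eval_at (\<lambda>e\<in>arcs G. f e + f' e) \<gamma> = eval_at (\<lambda>e. f e + f' e) \<gamma>"
      "eval_at (\<lambda>i\<in>I. g i + g' i) a = eval_at (\<lambda>i. g i + g' i) a"
      using assms by (auto intro!: eval_at_cong)
    ultimately show ?thesis
      using that by (simp add: xy mult_harmonic aj_functional_apply eval_at_add_fun)
  qed
  then show ?thesis
    by (auto simp: carrier_dual_group aj_functional_def)
qed

lemma aj_functional_add:
  "aj_functional G I \<rho> (\<gamma> + \<gamma>') (a + a') =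
     aj_functional G I \<rho> \<gamma> a \<otimes>\<^bsub>dual_group H\<^esub> aj_functional G I \<rho> \<gamma>' a'"
  by (auto simp: mult_dual_group aj_functional_def eval_at_add fun_eq_iff)

lemma alpha_mod_eq: "alpha_mod G I \<rho> \<gamma> = aj_functional G I \<rho> \<gamma> 0"
  by (simp add: alpha_mod_def aj_functional_def)

text \<open>\<open>H1 G\<close> is a kernel, hence a subgroup, and its image under a homomorphism is
  a subgroup of a commutative group.\<close>

lemma alpha_image_normal: "alpha_mod G I \<rho> ` H1 G \<lhd> dual_group H"
proof -
  interpret D: comm_group "dual_group H"
    by (rule comm_group_dual_group[OF group_harmonic])
  have "boundary G \<in> hom (free_Abelian_group (arcs G)) (free_Abelian_group (verts G))"
    using keys_boundary by (auto simp: hom_def boundary_add)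
  then interpret B: group_hom "free_Abelian_group (arcs G)" "free_Abelian_group (verts G)" "boundary G"
    by (simp add: group_hom_def group_hom_axioms_def)
  have "alpha_mod G I \<rho> \<in> hom (free_Abelian_group (arcs G)) (dual_group H)"
    using aj_functional_add[where a = 0 and a' = 0]
    by (auto simp: hom_def alpha_mod_eq aj_functional_in_dual)
  then interpret A: group_hom "free_Abelian_group (arcs G)" "dual_group H" "alpha_mod G I \<rho>"
    by (simp add: group_hom_def group_hom_axioms_def)
  show ?thesis
    unfolding H1_def
    by (intro D.subgroup_imp_normal A.subgroup_img_is_subgroup B.subgroup_kernel)
qed

text \<open>The source of surjectivity: the extension of \<open>\<phi>\<close> to all chains of
  \<open>X\<close> is determined by its values \<open>b\<close> on edges, which split into
  \<open>\<gamma>\<close> on old edges and \<open>a\<close> on added ones.\<close>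

lemma dual_element_eq_aj_functional:
  assumes "\<phi> \<in> carrier (dual_group H)"
  obtains \<gamma> a where "Poly_Mapping.keys \<gamma> \<subseteq> arcs G" "Poly_Mapping.keys a \<subseteq> I"
    "\<phi> = aj_functional G I \<rho> \<gamma> a"
proof -
  obtain p where "rooted_graph X None p" using extended_graph_rooted ..
  then interpret X: rooted_graph X None p .
  have mem: "harmonic_of z \<in> carrier H" if "z \<in> H1 X" for z
    using that by (simp add: harmonic_of_mem_iff mem_H1_iff[of z])
  define b where "b = (\<lambda>s. \<phi> (harmonic_of (X.loop s)))"
  have b: "\<phi> (harmonic_of z) = eval_at b z" if "z \<in> H1 X" for z
    unfolding b_def using assms that
    by (intro X.additive_on_cycles_eq_eval_at[where \<phi> = "\<lambda>z. \<phi> (harmonic_of z)"])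
      (auto simp: harmonic_of_add carrier_dual_group mem)
  define \<gamma> a where "\<gamma> = frag_of_fun (arcs G) (\<lambda>e. b (Inl e))" and "a = frag_of_fun I (\<lambda>i. b (Inr i))"
  have keys: "Poly_Mapping.keys \<gamma> \<subseteq> arcs G" "Poly_Mapping.keys a \<subseteq> I"
    by (simp_all add: \<gamma>_def a_def keys_frag_of_fun finite_I)
  have "\<phi> x = aj_functional G I \<rho> \<gamma> a x" if "x \<in> carrier H" for x
  proof -
    obtain z where z: "z \<in> H1 X" "harmonic_of z = x"
      using \<open>x \<in> carrier H\<close> harmonic_of_surj[of "fst x" "snd x"] by (metis prod.collapse)
    then have "eval_at b z = eval_at (case_sum (Poly_Mapping.lookup \<gamma>) (Poly_Mapping.lookup a)) z"
      by (intro eval_at_cong) (auto simp: mem_H1_iff \<gamma>_def a_def lookup_frag_of_fun finite_I)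
    with z show ?thesis
      using b[OF z(1)] aj_functional_harmonic_of[OF z(1) keys] by simp
  qed
  moreover have "aj_functional G I \<rho> \<gamma> a \<in> extensional (carrier H)"
    by (simp add: aj_functional_def)
  ultimately have "\<phi> = aj_functional G I \<rho> \<gamma> a"
    using assms by (intro extensionalityI[of _ "carrier H"]) (auto simp: carrier_dual_group)
  with keys show thesis by (rule that)
qed

text \<open>By adjunction the value at \<open>(f, g)\<close> is the vertex component of
  \<open>codiff_mod\<close> evaluated at \<open>c\<close>, which is zero for harmonic pairs.\<close>

lemma aj_functional_coboundary:
  assumes "Poly_Mapping.keys c \<subseteq> verts G"
  shows "aj_functional G I \<rho> (coboundary G c) (frag_extend (\<lambda>v. \<Sum>i\<in>fiber I \<rho> v. frag_of i) c) =
     \<one>\<^bsub>dual_group H\<^esub>"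
proof -
  have "eval_at f (coboundary G c) + eval_at g (frag_extend (\<lambda>v. \<Sum>i\<in>fiber I \<rho> v. frag_of i) c) = 0"
    if "(f, g) \<in> carrier H" for f g
  proof -
    have "eval_at f (coboundary G c) = eval_at (codiff G f) c"
      unfolding eval_at_coboundary using assms by (intro eval_at_cong) (auto simp: codiff_def)
    then have "eval_at f (coboundary G c) + eval_at g (frag_extend (\<lambda>v. \<Sum>i\<in>fiber I \<rho> v. frag_of i) c)
        = eval_at (\<lambda>v. codiff G f v + (\<Sum>i\<in>fiber I \<rho> v. g i)) c"
      by (simp add: eval_at_frag_extend eval_at_sum eval_at_add_fun)
    also have "\<dots> = eval_at (\<lambda>_. 0) c"
      using that assms by (intro eval_at_cong) (auto simp: mem_harmonic_iff)
    finally show ?thesis by (simp add: eval_at_def)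
  qed
  then show ?thesis
    by (auto simp: aj_functional_def one_dual_group fun_eq_iff)
qed

text \<open>Converse of \<open>aj_functional_coboundary\<close>: the potential of the vanishing
  functional supplies the coefficients of \<open>c\<close>.\<close>

lemma aj_functional_eq_one_imp_coboundary:
  assumes keys: "Poly_Mapping.keys \<gamma> \<subseteq> arcs G" "Poly_Mapping.keys a \<subseteq> I"
    and one: "aj_functional G I \<rho> \<gamma> a = \<one>\<^bsub>dual_group H\<^esub>"
  obtains c where "Poly_Mapping.keys c \<subseteq> verts G" "\<gamma> = coboundary G c"
    "a = frag_extend (\<lambda>v. \<Sum>i\<in>fiber I \<rho> v. frag_of i) c"
proof -
  obtain p where "rooted_graph X None p" using extended_graph_rooted ..
  then interpret X: rooted_graph X None p .
  define b where "b = case_sum (Poly_Mapping.lookup \<gamma>) (Poly_Mapping.lookup a)"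
  have "eval_at b z = 0" if "z \<in> H1 X" for z
    using aj_functional_harmonic_of[OF that keys] harmonic_of_mem_iff[of z] that
    by (simp add: one one_dual_group b_def mem_H1_iff[of z])
  note potential = X.vanishing_on_cycles_imp_potential[OF this]
  define c where "c = frag_of_fun (verts G) (\<lambda>v. eval_at b (p (Some v)))"
  have c: "Poly_Mapping.keys c \<subseteq> verts G"
    and lookup_c: "v \<in> verts G \<Longrightarrow> Poly_Mapping.lookup c v = eval_at b (p (Some v))" for v
    by (simp_all add: c_def keys_frag_of_fun lookup_frag_of_fun)
  have "\<gamma> = coboundary G c"
  proof (rule poly_mapping_eqI)
    fix e
    show "Poly_Mapping.lookup \<gamma> e = Poly_Mapping.lookup (coboundary G c) e"
    proof (cases "e \<in> arcs G")
      case True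
      then show ?thesis
        using potential(1)[of "Inl e"] by (simp add: InlI lookup_coboundary lookup_c b_def)
    next
      case False
      then show ?thesis
        using keys(1) keys_coboundary[of c] by (metis in_keys_iff subsetD)
    qed
  qed
  moreover have "a = frag_extend (\<lambda>v. \<Sum>i\<in>fiber I \<rho> v. frag_of i) c" (is "a = ?r")
  proof (rule poly_mapping_eqI)
    fix i
    show "Poly_Mapping.lookup a i = Poly_Mapping.lookup ?r i"
    proof (cases "i \<in> I")
      case True
      \<comment> \<open>The index \<open>i\<close> lies in the fiber over \<open>\<rho> i\<close>
        and in no other.\<close>
      have "(\<Sum>j\<in>fiber I \<rho> v. of_bool (j = i)) = (of_bool (v = \<rho> i) :: int)" for v
        using True finite_I by (auto simp: fiber_def of_bool_def)
      then have "Poly_Mapping.lookup ?r i = Poly_Mapping.lookup c (\<rho> i)"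
        by (simp add: lookup_conv_eval_at eval_at_frag_extend eval_at_sum)
      then show ?thesis
        \<comment> \<open>The edge \<open>Inr i\<close> starts at the added vertex, where the
          potential is zero, so only its value at \<open>\<rho> i\<close> remains.\<close>
        using potential(1)[of "Inr i"] potential(2) True
        by (simp add: InrI lookup_c modulus_in_verts b_def)
    next
      case False
      have "Poly_Mapping.keys ?r \<subseteq> I"
        by (rule keys_frag_extend_subset[OF c]) (auto simp: fiber_def intro!: keys_sum_frag_of_subset)
      then show ?thesis
        using keys(2) False by (metis in_keys_iff subsetD)
    qed
  qed
  ultimately show thesis using c by (rule that[rotated])
qed

section \<open>Divisors, surjectivity and kernel\<close>

lemma carrier_Div0:
  "carrier (Div0 G I) = {(D, a). Poly_Mapping.keys D \<subseteq> verts G \<and> deg D = 0 \<and> Poly_Mapping.keys a \<subseteq> I}"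
  by (auto simp: Div0_def)

lemma mult_Div0: "(D, a) \<otimes>\<^bsub>Div0 G I\<^esub> (D', a') = (D + D', a + a')"
  by (simp add: Div0_def)

lemma group_Div0: "group (Div0 G I)"
proof -
  have "subgroup {D \<in> carrier (free_Abelian_group (verts G)). deg D = 0} (free_Abelian_group (verts G))"
    by (rule group.subgroupI)
      (auto simp: deg_conv_eval_at eval_at_add eval_at_minus keys_add_subset intro: exI[of _ 0])
  then show ?thesis
    unfolding Div0_def by (intro DirProd_group subgroup.subgroup_is_group) auto
qed

text \<open>Puts every divisor in the form on which \<open>AJ_tilde_pair\<close> computes the map
  without the arbitrary choice of chain.\<close>

lemma Div0_cases:
  assumes "x \<in> carrier (Div0 G I)"
  obtains \<gamma> a where "Poly_Mapping.keys \<gamma> \<subseteq> arcs G" "Poly_Mapping.keys a \<subseteq> I" "x = (boundary G \<gamma>, a)"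
proof -
  have "Poly_Mapping.keys (fst x) \<subseteq> verts G" "deg (fst x) = 0" "Poly_Mapping.keys (snd x) \<subseteq> I"
    using assms by (auto simp: carrier_Div0)
  then show thesis
    using deg_0_imp_boundary[OF connected_G] that by (metis prod.collapse)
qed

lemma boundary_in_Div0:
  "Poly_Mapping.keys \<gamma> \<subseteq> arcs G \<Longrightarrow> Poly_Mapping.keys a \<subseteq> I \<Longrightarrow> (boundary G \<gamma>, a) \<in> carrier (Div0 G I)"
  by (simp add: carrier_Div0 keys_boundary deg_boundary)

text \<open>On pairs \<open>(boundary G \<gamma>, a)\<close> the map is the class of
  \<open>aj_functional\<close>, which is additive in both arguments and reaches every
  functional.\<close>

lemma AJ_tilde_epi: "AJ_tilde G I \<rho> \<in> epi (Div0 G I) (Jac_mod G I \<rho>)"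
proof -
  interpret N: normal "alpha_mod G I \<rho> ` H1 G" "dual_group H"
    by (rule alpha_image_normal)
  have "AJ_tilde G I \<rho> \<in> hom (Div0 G I) (Jac_mod G I \<rho>)"
  proof (rule homI)
    fix x assume "x \<in> carrier (Div0 G I)"
    then show "AJ_tilde G I \<rho> x \<in> carrier (Jac_mod G I \<rho>)"
      by (rule Div0_cases)
        (auto simp: AJ_tilde_pair Jac_mod_def Jac_class_def carrier_FactGroup aj_functional_in_dual)
  next
    fix x y assume "x \<in> carrier (Div0 G I)" "y \<in> carrier (Div0 G I)"
    then obtain \<gamma> a \<gamma>' a' where
      *: "Poly_Mapping.keys \<gamma> \<subseteq> arcs G" "Poly_Mapping.keys a \<subseteq> I" "x = (boundary G \<gamma>, a)"
      "Poly_Mapping.keys \<gamma>' \<subseteq> arcs G" "Poly_Mapping.keys a' \<subseteq> I" "y = (boundary G \<gamma>', a')"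
      by (metis Div0_cases)
    have "AJ_tilde G I \<rho> (x \<otimes>\<^bsub>Div0 G I\<^esub> y) = Jac_class G I \<rho> (aj_functional G I \<rho> (\<gamma> + \<gamma>') (a + a'))"
      unfolding * mult_Div0 boundary_add[symmetric] using *
      by (intro AJ_tilde_pair) (simp add: keys_add_subset)
    also have "\<dots> = AJ_tilde G I \<rho> x \<otimes>\<^bsub>Jac_mod G I \<rho>\<^esub> AJ_tilde G I \<rho> y"
      using * by (simp add: AJ_tilde_pair Jac_mod_def Jac_class_def aj_functional_add
          aj_functional_in_dual N.rcos_sum)
    finally show "AJ_tilde G I \<rho> (x \<otimes>\<^bsub>Div0 G I\<^esub> y) = \<dots>" .
  qed
  moreover have "carrier (Jac_mod G I \<rho>) \<subseteq> AJ_tilde G I \<rho> ` carrier (Div0 G I)"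
  proof
    fix j assume "j \<in> carrier (Jac_mod G I \<rho>)"
    then obtain \<phi> where "\<phi> \<in> carrier (dual_group H)" "j = Jac_class G I \<rho> \<phi>"
      by (auto simp: Jac_mod_def Jac_class_def carrier_FactGroup)
    then obtain \<gamma> a where "Poly_Mapping.keys \<gamma> \<subseteq> arcs G" "Poly_Mapping.keys a \<subseteq> I"
      and "j = Jac_class G I \<rho> (aj_functional G I \<rho> \<gamma> a)"
      by (metis dual_element_eq_aj_functional)
    then show "j \<in> AJ_tilde G I \<rho> ` carrier (Div0 G I)"
      by (intro image_eqI[of _ _ "(boundary G \<gamma>, a)"]) (auto simp: AJ_tilde_pair boundary_in_Div0)
  qed
  ultimately show ?thesis
    by (auto simp: epi_def hom_def)
qed

lemma kernel_AJ_tilde: "kernel (Div0 G I) (Jac_mod G I \<rho>) (AJ_tilde G I \<rho>) = Prin G I \<rho>"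
proof -
  interpret N: normal "alpha_mod G I \<rho> ` H1 G" "dual_group H"
    by (rule alpha_image_normal)
  have one: "\<one>\<^bsub>Jac_mod G I \<rho>\<^esub> = alpha_mod G I \<rho> ` H1 G"
    by (simp add: Jac_mod_def)
  let ?r = "frag_extend (\<lambda>v. \<Sum>i\<in>fiber I \<rho> v. frag_of i)"
  show ?thesis
  proof (intro equalityI subsetI)
    fix x assume "x \<in> kernel (Div0 G I) (Jac_mod G I \<rho>) (AJ_tilde G I \<rho>)"
    then have x: "x \<in> carrier (Div0 G I)" "AJ_tilde G I \<rho> x = alpha_mod G I \<rho> ` H1 G"
      by (auto simp: kernel_def one)
    from x(1) obtain \<gamma> a where keys: "Poly_Mapping.keys \<gamma> \<subseteq> arcs G" "Poly_Mapping.keys a \<subseteq> I"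
      and x_eq: "x = (boundary G \<gamma>, a)" by (rule Div0_cases)
    \<comment> \<open>A trivial class contains the zero functional, which is therefore the
      functional of \<open>\<gamma>\<close> corrected by some cycle \<open>\<eta>\<close>.\<close>
    have "\<one>\<^bsub>dual_group H\<^esub> \<in> Jac_class G I \<rho> (aj_functional G I \<rho> \<gamma> a)"
      using x(2) N.one_closed keys(1) by (simp add: x_eq AJ_tilde_pair)
    then obtain \<eta> where \<eta>: "\<eta> \<in> H1 G" "aj_functional G I \<rho> (\<eta> + \<gamma>) a = \<one>\<^bsub>dual_group H\<^esub>"
      by (auto simp: mem_Jac_class_iff)
    have "Poly_Mapping.keys (\<eta> + \<gamma>) \<subseteq> arcs G"
      using \<eta>(1) keys(1) by (simp add: mem_H1_iff keys_add_subset)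
    then obtain c where "Poly_Mapping.keys c \<subseteq> verts G" "\<eta> + \<gamma> = coboundary G c" "a = ?r c"
      using aj_functional_eq_one_imp_coboundary keys(2) \<eta>(2) by metis
    \<comment> \<open>The correction leaves the divisor unchanged, so its first component is the
      Laplacian of \<open>c\<close>.\<close>
    moreover have "boundary G \<gamma> = boundary G (\<eta> + \<gamma>)"
      using \<eta>(1) by (simp add: boundary_add mem_H1_iff)
    ultimately show "x \<in> Prin G I \<rho>"
      by (auto simp: Prin_def laplacian_def x_eq)
  next
    fix x assume "x \<in> Prin G I \<rho>"
    then obtain c where c: "Poly_Mapping.keys c \<subseteq> verts G"
      and x: "x = (boundary G (coboundary G c), ?r c)"
      by (auto simp: Prin_def laplacian_def)
    have "Poly_Mapping.keys (?r c) \<subseteq> I"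
      by (rule keys_frag_extend_subset[OF c]) (auto simp: fiber_def intro!: keys_sum_frag_of_subset)
    moreover have "AJ_tilde G I \<rho> x = alpha_mod G I \<rho> ` H1 G"
      using N.coset_join2[OF N.one_closed N.subgroup_axioms]
      by (simp add: x AJ_tilde_pair keys_coboundary aj_functional_coboundary[OF c] Jac_class_def)
    ultimately show "x \<in> kernel (Div0 G I) (Jac_mod G I \<rho>) (AJ_tilde G I \<rho>)"
      by (simp add: kernel_def one x boundary_in_Div0 keys_coboundary)
  qed
qed

end

theorem theorem3p3p4:
  fixes G :: "('v, 'e) pre_digraph" and I :: "'i set" and \<rho> :: "'i \<Rightarrow> 'v"
  assumes "fin_digraph G" and "connected G"
    and "finite I" and "I \<noteq> {}" and "\<rho> \<in> I \<rightarrow> verts G"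
  shows "AJ_tilde G I \<rho> \<in> epi (Div0 G I) (Jac_mod G I \<rho>)
    \<and> kernel (Div0 G I) (Jac_mod G I \<rho>) (AJ_tilde G I \<rho>) = Prin G I \<rho>
    \<and> AJ G I \<rho> \<in> iso (Cl0 G I \<rho>) (Jac_mod G I \<rho>)
    \<and> (\<forall>D\<in>carrier (Div0 G I).
         AJ G I \<rho> (Prin G I \<rho> #>\<^bsub>Div0 G I\<^esub> D) = AJ_tilde G I \<rho> D)"
proof -
  interpret fin_digraph G by fact
  interpret graph_with_modulus G I \<rho>
    using assms by unfold_locales auto
  have "group (Jac_mod G I \<rho>)"
    unfolding Jac_mod_def by (rule normal.factorgroup_is_group[OF alpha_image_normal])
  then interpret group_hom "Div0 G I" "Jac_mod G I \<rho>" "AJ_tilde G I \<rho>"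
    using AJ_tilde_epi by (simp add: group_hom_def group_hom_axioms_def group_Div0 epi_def)
  \<comment> \<open>The first isomorphism theorem: \<open>AJ\<close> has the form of the induced map
    in \<open>FactGroup_iso_set\<close>, and the kernel is \<open>Prin\<close>.\<close>
  have "AJ G I \<rho> \<in> iso (Cl0 G I \<rho>) (Jac_mod G I \<rho>)"
    using FactGroup_iso_set AJ_tilde_epi unfolding AJ_def[abs_def] Cl0_def kernel_AJ_tilde
    by (simp add: epi_def)
  moreover have "AJ G I \<rho> (Prin G I \<rho> #>\<^bsub>Div0 G I\<^esub> D) = AJ_tilde G I \<rho> D"
    if D: "D \<in> carrier (Div0 G I)" for D
  proof -
    \<comment> \<open>The map is constant on the coset, so \<open>the_elem\<close> in
      \<open>AJ\<close> returns the common value.\<close>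
    have "AJ_tilde G I \<rho> ` (Prin G I \<rho> #>\<^bsub>Div0 G I\<^esub> D) = {AJ_tilde G I \<rho> D}"
    proof -
      have "AJ_tilde G I \<rho> y = AJ_tilde G I \<rho> D" if "y \<in> Prin G I \<rho> #>\<^bsub>Div0 G I\<^esub> D" for y
        using that D by (auto simp: r_coset_def kernel_def simp flip: kernel_AJ_tilde)
      moreover have "D \<in> Prin G I \<rho> #>\<^bsub>Div0 G I\<^esub> D"
        using G.rcos_self[OF D subgroup_kernel] by (simp add: kernel_AJ_tilde)
      ultimately show ?thesis by blast
    qed
    then show ?thesis by (simp add: AJ_def)
  qed
  ultimately show ?thesis
    using AJ_tilde_epi kernel_AJ_tilde by blast
qed

end
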